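(* Let $\varphi:\mathbb{R}^n\to\mathbb{R}$ be a $\mathcal{C}^{1,1}$-smooth function such that for all $x\in\mathbb{R}^n$ and $u\in\mathbb{R}^n\setminus\{0\}$ with $\langle\nabla\varphi(x),u\rangle=0$ there exists $z\in\widehat\partial^2\varphi(x)(u)\cup\bigl(-\widehat\partial^2\varphi(x)(-u)\bigr)$ with $\langle z,u\rangle>0$. Then $\varphi$ is strictly quasiconvex.
   Context: $\mathcal{C}^{1,1}$-smooth: $\varphi$ is Fréchet differentiable on $\mathbb{R}^n$ and its gradient $\nabla\varphi:\mathbb{R}^n\to\mathbb{R}^n$ is locally Lipschitz. Strictly quasiconvex: $\varphi((1-\lambda)x+\lambda y)<\max\{\varphi(x),\varphi(y)\}$ for all $x,y\in\mathbb{R}^n$ with $x\ne y$ and all $\lambda\in(0,1)$. For a proper lower semicontinuous $\psi:\mathbb{R}^m\to(-\infty,\infty]$ and $\bar x$ with $\psi(\bar x)<\infty$, the Fréchet subdifferential is $\widehat\partial\psi(\bar x)=\{x^*\in\mathbb{R}^m : \liminf_{x\to\bar x}\frac{\psi(x)-\psi(\bar x)-\langle x^*,x-\bar x\rangle}{\|x-\bar x\|}\ge 0\}$. For a set $\Omega$ and $p\in\Omega$, the Fréchet normal cone is $\widehat N(p;\Omega)=\widehat\partial\delta_\Omega(p)$, where $\delta_\Omega$ equals $0$ on $\Omega$ and $\infty$ elsewhere. Fréchet second-order subdifferential of a $\mathcal{C}^{1,1}$-smooth $\varphi$: it is the Fréchet coderivative of the gradient mapping, i.e. for $x,u\in\mathbb{R}^n$,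 $\widehat\partial^2\varphi(x)(u)=\{z\in\mathbb{R}^n : (z,-u)\in\widehat N((x,\nabla\varphi(x));\mathrm{gph}\,\nabla\varphi)\}$, where $\mathrm{gph}\,\nabla\varphi=\{(y,\nabla\varphi(y)) : y\in\mathbb{R}^n\}\subset\mathbb{R}^n\times\mathbb{R}^n$. This set may be empty. For a set $A\subset\mathbb{R}^n$, $-A=\{-a : a\in A\}$; thus $-\widehat\partial^2\varphi(x)(-u)=\{-w : w\in\widehat\partial^2\varphi(x)(-u)\}$. *)

theory Defs
  imports "HOL-Analysis.Analysis"
begin

definition gradient :: "('a::euclidean_space \<Rightarrow> real) \<Rightarrow> 'a \<Rightarrow> 'a" where
  "gradient \<phi> x = (THE D. GDERIV \<phi> x :> D)"

(* THE is well-defined at every point of differentiability. *)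
lemma GDERIV_gradient:
  fixes \<phi> :: "'a::euclidean_space \<Rightarrow> real"
  assumes "\<phi> differentiable (at x)"
  shows "GDERIV \<phi> x :> gradient \<phi> x"
proof -
  obtain f where f: "(\<phi> has_derivative f) (at x)"
    using assms by (auto simp: differentiable_def)
  then have lin: "linear f"
    by (rule has_derivative_linear)
  define D where "D = adjoint f 1"
  have "f = (\<lambda>h. inner h D)"
    by (simp add: fun_eq_iff D_def adjoint_works[OF lin])
  then have D: "GDERIV \<phi> x :> D"
    using f by (simp add: gderiv_def)
  have "E = D" if "GDERIV \<phi> x :> E" for E
  proof -
    have "(\<lambda>h. inner h E) = (\<lambda>h. inner h D)"
      using that D unfolding gderiv_def by (rule has_derivative_unique)
    then have "\<forall>h. inner h E = inner h D"
      by (simp add: fun_eq_iff)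
    then show ?thesis
      by (simp add: vector_eq_ldot)
  qed
  with D show ?thesis
    unfolding gradient_def by (rule theI)
qed

definition C11_smooth :: "('a::euclidean_space \<Rightarrow> real) \<Rightarrow> bool" where
  "C11_smooth \<phi> \<longleftrightarrow>
    (\<forall>x. \<phi> differentiable (at x)) \<and>
    (\<forall>x. \<exists>r>0. \<exists>L. L-lipschitz_on (ball x r) (gradient \<phi>))"

definition strictly_quasiconvex :: "('a::real_vector \<Rightarrow> real) \<Rightarrow> bool" where
  "strictly_quasiconvex \<phi> \<longleftrightarrow>
    (\<forall>x y. x \<noteq> y \<longrightarrow>
      (\<forall>l\<in>{0<..<1}. \<phi> ((1 - l) *\<^sub>R x + l *\<^sub>R y) < max (\<phi> x) (\<phi> y)))"

(* The subdifferential is only meaningful where psi is finite;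
   elsewhere it is empty by convention. *)
definition frechet_subdifferential :: "('a::euclidean_space \<Rightarrow> ereal) \<Rightarrow> 'a \<Rightarrow> 'a set" where
  "frechet_subdifferential \<psi> x =
    {v. \<bar>\<psi> x\<bar> \<noteq> \<infinity> \<and>
        Liminf (at x) (\<lambda>y. (\<psi> y - \<psi> x - ereal (inner v (y - x))) / ereal (norm (y - x))) \<ge> 0}"

(* The indicator function of convex analysis, not the library's 0-1 valued indicator. *)
definition set_delta :: "'a set \<Rightarrow> 'a \<Rightarrow> ereal" where
  "set_delta \<Omega> p = (if p \<in> \<Omega> then 0 else \<infinity>)"

definition frechet_normal_cone :: "'a::euclidean_space \<Rightarrow> 'a set \<Rightarrow> 'a set" where
  "frechet_normal_cone p \<Omega> = frechet_subdifferential (set_delta \<Omega>) p"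

definition graph_of :: "('a \<Rightarrow> 'b) \<Rightarrow> ('a \<times> 'b) set" where
  "graph_of F = range (\<lambda>y. (y, F y))"

definition frechet_coderivative ::
  "('a::euclidean_space \<Rightarrow> 'b::euclidean_space) \<Rightarrow> 'a \<Rightarrow> 'b \<Rightarrow> 'a set" where
  "frechet_coderivative F x u = {z. (z, - u) \<in> frechet_normal_cone (x, F x) (graph_of F)}"

definition frechet_subdifferential2 :: "('a::euclidean_space \<Rightarrow> real) \<Rightarrow> 'a \<Rightarrow> 'a \<Rightarrow> 'a set" where
  "frechet_subdifferential2 \<phi> x u = frechet_coderivative (gradient \<phi>) x u"

end

theory Submission
  imports Defs
begin

text \<open>
  Along the line \<open>x + t u\<close>, the normal cone inequality for \<open>z\<close> in the coderivative at \<open>u\<close>,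
  combined with the Lipschitz bound on the gradient, gives
  \<open>\<langle>u, \<nabla>\<phi>(x + t u) - \<nabla>\<phi>(x)\<rangle> \<ge> t \<langle>z, u\<rangle> - o(t)\<close> for \<open>t > 0\<close>. So at every critical
  point of a restriction of \<open>\<phi>\<close> to a line, \<open>\<phi>\<close> strictly increases when the point is left in at
  least one of the two directions (which one depends on the set of the union containing \<open>z\<close>).
  Hence no such restriction attains a maximum over a segment at an interior point, whereas a
  failure of strict quasiconvexity would produce one.
\<close>

lemma GDERIV_line:
  assumes "GDERIV \<phi> (x + t *\<^sub>R u) :> D"
  shows "((\<lambda>s. \<phi> (x + s *\<^sub>R u)) has_real_derivative inner u D) (at t)"
proof -
  have "((\<lambda>s. x + s *\<^sub>R u) has_derivative (\<lambda>h. h *\<^sub>R u)) (at t)"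
    by (auto intro!: derivative_eq_intros)
  moreover have "(\<phi> has_derivative (\<lambda>h. inner h D)) (at (x + t *\<^sub>R u))"
    using assms by (simp add: gderiv_def)
  ultimately have "((\<lambda>s. \<phi> (x + s *\<^sub>R u)) has_derivative (\<lambda>h. inner (h *\<^sub>R u) D)) (at t)"
    by (rule has_derivative_compose)
  then show ?thesis
    by (simp add: has_field_derivative_def mult.commute[of _ "inner u D"])
qed

text \<open>At points of \<open>\<Omega>\<close> both indicator terms vanish, so the difference
  quotient is minus the normalized inner product. A nonnegative \<open>Liminf\<close> keeps it
  eventually above \<open>- \<epsilon>\<close>, and multiplying by the norm gives the bound. Off
  \<open>\<Omega>\<close> the quotient is infinite and carries no information.\<close>

lemma frechet_normal_cone_eventually:
  assumes "v \<in> frechet_normal_cone p \<Omega>" and "p \<in> \<Omega>" and "\<epsilon> > 0"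
  shows "\<forall>\<^sub>F q in at p. q \<in> \<Omega> \<longrightarrow> inner v (q - p) < \<epsilon> * norm (q - p)"
proof -
  define Q where "Q q = (set_delta \<Omega> q - set_delta \<Omega> p - ereal (inner v (q - p)))
    / ereal (norm (q - p))" for q
  have "0 \<le> Liminf (at p) Q"
    using assms(1) by (simp add: frechet_normal_cone_def frechet_subdifferential_def Q_def[abs_def])
  moreover have "ereal (- \<epsilon>) < 0"
    using assms(3) by simp
  ultimately have "\<forall>\<^sub>F q in at p. ereal (- \<epsilon>) < Q q"
    using le_Liminf_iff by blast
  moreover have "\<forall>\<^sub>F q in at p. q \<noteq> p"
    by (simp add: eventually_at_filter)
  ultimately show ?thesis
  proof eventually_elim
    case (elim q)
    show ?case
    proof
      assume "q \<in> \<Omega>"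
      then have "Q q = ereal (- inner v (q - p) / norm (q - p))"
        using assms(2) elim(2) by (simp add: Q_def set_delta_def)
      then show "inner v (q - p) < \<epsilon> * norm (q - p)"
        using elim by (simp add: field_simps)
    qed
  qed
qed

lemma frechet_coderivative_increasing:
  fixes F :: "'a::euclidean_space \<Rightarrow> 'a"
  assumes "z \<in> frechet_coderivative F x u" and "inner z u > 0"
    and "r > 0" and lip: "L-lipschitz_on (ball x r) F"
  shows "\<forall>\<^sub>F t in at_right 0. inner u (F x) < inner u (F (x + t *\<^sub>R u))"
proof -
  have "u \<noteq> 0"
    using assms(2) by auto
  have "L \<ge> 0"
    using lip by (rule lipschitz_on_nonneg)
  \<comment> \<open>\<open>C\<close> bounds the rate at which the graph point over
    \<open>x + t *\<^sub>R u\<close> moves away from its start: norm \<open>u\<close> in the first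
    component, at most \<open>L\<close> times that in the second. With this
    \<open>\<epsilon>\<close> the error term in the normal cone inequality is at most
    \<open>t * inner z u\<close>.\<close>
  define C where "C = (1 + L) * norm u"
  define \<epsilon> where "\<epsilon> = inner z u / C"
  have "C > 0"
    using \<open>u \<noteq> 0\<close> \<open>L \<ge> 0\<close> by (simp add: C_def)
  then have "\<epsilon> > 0"
    using assms(2) by (simp add: \<epsilon>_def)
  define q where "q t = (x + t *\<^sub>R u, F (x + t *\<^sub>R u))" for t
  have "continuous_on (ball x r) F"
    using lip by (rule lipschitz_on_continuous_on)
  then have cont: "isCont F x"
    using \<open>r > 0\<close> by (simp add: continuous_on_eq_continuous_at)
  have line: "((\<lambda>t. x + t *\<^sub>R u) \<longlongrightarrow> x) (at_right 0)"
    by (auto intro!: tendsto_eq_intros)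
  have "(q \<longlongrightarrow> (x, F x)) (at_right 0)"
    unfolding q_def by (intro tendsto_Pair line isCont_tendsto_compose[OF cont])
  moreover have pos: "\<forall>\<^sub>F t in at_right 0. t > (0::real)"
    by (rule eventually_at_right_less)
  \<comment> \<open>The normal cone inequality holds only on a punctured neighbourhood, so the curve
    \<open>q\<close> must avoid the base point; its first component already does.\<close>
  then have "\<forall>\<^sub>F t in at_right 0. q t \<noteq> (x, F x)"
    by eventually_elim (use \<open>u \<noteq> 0\<close> in \<open>simp add: q_def\<close>)
  ultimately have "filterlim q (at (x, F x)) (at_right 0)"
    by (simp add: filterlim_at)
  moreover have "(z, - u) \<in> frechet_normal_cone (x, F x) (graph_of F)"
    using assms(1) by (simp add: frechet_coderivative_def)
  then have "\<forall>\<^sub>F p in at (x, F x). p \<in> graph_of F \<longrightarrow>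
      inner (z, - u) (p - (x, F x)) < \<epsilon> * norm (p - (x, F x))"
    using \<open>\<epsilon> > 0\<close> by (intro frechet_normal_cone_eventually) (auto simp: graph_of_def)
  ultimately have "\<forall>\<^sub>F t in at_right 0. q t \<in> graph_of F \<longrightarrow>
      inner (z, - u) (q t - (x, F x)) < \<epsilon> * norm (q t - (x, F x))"
    by (rule eventually_compose_filterlim[rotated])
  moreover have "\<forall>\<^sub>F t in at_right 0. x + t *\<^sub>R u \<in> ball x r"
    using \<open>r > 0\<close> by (intro topological_tendstoD[OF line]) auto
  ultimately show ?thesis
    using pos
  proof eventually_elim
    case (elim t)
    define \<Delta> where "\<Delta> = F (x + t *\<^sub>R u) - F x"
    have "dist (F (x + t *\<^sub>R u)) (F x) \<le> L * dist (x + t *\<^sub>R u) x"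
      using elim \<open>r > 0\<close> by (intro lipschitz_onD[OF lip]) auto
    then have "norm \<Delta> \<le> L * (t * norm u)"
      using elim by (simp add: \<Delta>_def dist_norm)
    moreover have "norm (t *\<^sub>R u, \<Delta>) \<le> t * norm u + norm \<Delta>"
      using norm_Pair_le[of "t *\<^sub>R u" \<Delta>] elim by simp
    ultimately have "norm (t *\<^sub>R u, \<Delta>) \<le> t * C"
      by (simp add: C_def algebra_simps)
    then have "\<epsilon> * norm (t *\<^sub>R u, \<Delta>) \<le> \<epsilon> * (t * C)"
      using \<open>\<epsilon> > 0\<close> by (intro mult_left_mono) auto
    also have "\<dots> = t * inner z u"
      using \<open>C > 0\<close> by (simp add: \<epsilon>_def)
    finally have "\<epsilon> * norm (t *\<^sub>R u, \<Delta>) \<le> t * inner z u" .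
    \<comment> \<open>The left side is the pairing of \<open>(z, - u)\<close> with the graph
      increment. Since this bound is strict, an error of at most \<open>t * inner z u\<close> still
      forces \<open>inner u \<Delta>\<close> to be positive.\<close>
    moreover have "t * inner z u - inner u \<Delta> < \<epsilon> * norm (t *\<^sub>R u, \<Delta>)"
      using elim(1) by (simp add: q_def graph_of_def \<Delta>_def)
    ultimately have "inner u \<Delta> > 0"
      by linarith
    then show ?case
      by (simp add: \<Delta>_def inner_diff_right)
  qed
qed

text \<open>The restriction of \<open>\<phi>\<close> to the line has derivative zero at
  \<open>t = 0\<close> and, by the coderivative estimate, positive derivative just to the right. The
  mean value theorem turns this into strict growth.\<close>

lemma increasing_along_direction:
  fixes \<phi> :: "'a::euclidean_space \<Rightarrow> real"
  assumes "C11_smooth \<phi>" and "inner (gradient \<phi> x) u = 0"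
    and "z \<in> frechet_subdifferential2 \<phi> x u" and "inner z u > 0"
  shows "\<forall>\<^sub>F t in at_right 0. \<phi> x < \<phi> (x + t *\<^sub>R u)"
proof -
  obtain r L where "r > 0" "L-lipschitz_on (ball x r) (gradient \<phi>)"
    using assms(1) unfolding C11_smooth_def by blast
  then have "\<forall>\<^sub>F t in at_right 0. inner u (gradient \<phi> x) < inner u (gradient \<phi> (x + t *\<^sub>R u))"
    using assms(3,4) unfolding frechet_subdifferential2_def
    by (intro frechet_coderivative_increasing)
  then obtain b where b: "b > 0" "\<And>t. 0 < t \<Longrightarrow> t < b \<Longrightarrow> 0 < inner u (gradient \<phi> (x + t *\<^sub>R u))"
    using assms(2) by (auto simp: eventually_at_right_field inner_commute)
  have deriv: "((\<lambda>s. \<phi> (x + s *\<^sub>R u)) has_real_derivative inner u (gradient \<phi> (x + t *\<^sub>R u))) (at t)"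
    for t
    using assms(1) by (intro GDERIV_line GDERIV_gradient) (simp add: C11_smooth_def)
  have "\<phi> x < \<phi> (x + t *\<^sub>R u)" if "0 < t" "t < b" for t
  proof -
    obtain s where "0 < s" "s < t"
      and "\<phi> (x + t *\<^sub>R u) - \<phi> (x + 0 *\<^sub>R u) = (t - 0) * inner u (gradient \<phi> (x + s *\<^sub>R u))"
      using MVT2[OF \<open>0 < t\<close> deriv] by blast
    then show ?thesis
      using b(2)[of s] that by (simp add: algebra_simps)
  qed
  then show ?thesis
    using b(1) by (auto simp: eventually_at_right_field)
qed

theorem theorem4p3:
  fixes \<phi> :: "real ^ 'n \<Rightarrow> real"
  assumes "C11_smooth \<phi>"
    and "\<And>x u. u \<noteq> 0 \<Longrightarrow> inner (gradient \<phi> x) u = 0 \<Longrightarrow>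
      \<exists>z \<in> frechet_subdifferential2 \<phi> x u \<union> uminus ` frechet_subdifferential2 \<phi> x (- u).
        inner z u > 0"
  shows "strictly_quasiconvex \<phi>"
proof (rule ccontr)
  assume "\<not> strictly_quasiconvex \<phi>"
  then obtain x y :: "real ^ 'n" and l :: real where "x \<noteq> y" and l: "0 < l" "l < 1"
    and ge: "max (\<phi> x) (\<phi> y) \<le> \<phi> ((1 - l) *\<^sub>R x + l *\<^sub>R y)"
    unfolding strictly_quasiconvex_def by force
  define u where "u = y - x"
  define f where "f s = \<phi> (x + s *\<^sub>R u)" for s
  have "u \<noteq> 0"
    using \<open>x \<noteq> y\<close> by (simp add: u_def)
  have deriv: "(f has_real_derivative inner u (gradient \<phi> (x + t *\<^sub>R u))) (at t)" for t
    using assms(1) unfolding f_def by (intro GDERIV_line GDERIV_gradient) (simp add: C11_smooth_def)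
  have "f 0 \<le> f l" "f 1 \<le> f l"
    using ge by (simp_all add: f_def u_def algebra_simps)
  have "continuous_on {0..1} f"
    by (rule DERIV_continuous_on) (rule has_field_derivative_at_within[OF deriv])
  then obtain m where "m \<in> {0..1}" and m: "\<And>s. s \<in> {0..1} \<Longrightarrow> f s \<le> f m"
    using continuous_attains_sup[of "{0..1::real}" f] by auto
  \<comment> \<open>A maximizer may be an endpoint. In that case \<open>l\<close> is an interior
    maximizer too, because \<open>f l\<close> dominates both endpoint values.\<close>
  obtain c where c: "0 < c" "c < 1" and max: "\<And>s. s \<in> {0..1} \<Longrightarrow> f s \<le> f c"
  proof (cases "m = 0 \<or> m = 1")
    case True
    then have "f s \<le> f l" if "s \<in> {0..1}" for s
      using m[OF that] \<open>f 0 \<le> f l\<close> \<open>f 1 \<le> f l\<close> by auto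
    with l show ?thesis
      by (rule that)
  next
    case False
    with \<open>m \<in> {0..1}\<close> m show ?thesis
      by (intro that[of m]) auto
  qed
  define a where "a = x + c *\<^sub>R u"
  have "inner u (gradient \<phi> a) = 0"
  proof (rule DERIV_local_max)
    show "(f has_real_derivative inner u (gradient \<phi> a)) (at c)"
      unfolding a_def by (rule deriv)
    show "0 < min c (1 - c)"
      using c by simp
    show "\<forall>s. \<bar>c - s\<bar> < min c (1 - c) \<longrightarrow> f s \<le> f c"
      by (intro allI impI max) (auto simp: abs_less_iff)
  qed
  then have crit: "inner (gradient \<phi> a) u = 0"
    by (simp add: inner_commute)
  \<comment> \<open>The sign \<open>\<sigma>\<close> treats both directions along the line at once;
    steps shorter than \<open>min c (1 - c)\<close> stay in the segment, where \<open>f c\<close> is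
    maximal.\<close>
  have no_increase: False if "\<forall>\<^sub>F t in at_right 0. f c < f (c + \<sigma> * t)" "\<bar>\<sigma>\<bar> = 1" for \<sigma>
  proof -
    have "\<forall>\<^sub>F t in at_right 0. t \<in> {0<..<min c (1 - c)}"
      using c by (intro eventually_at_right_real) simp
    with that(1) have "\<forall>\<^sub>F t in at_right (0::real). False"
    proof eventually_elim
      case (elim t)
      then have "c + \<sigma> * t \<in> {0..1}"
        using that(2) by (auto simp: abs_if split: if_splits)
      with max elim show ?case
        by force
    qed
    then show ?thesis
      by simp
  qed
  obtain z where "inner z u > 0"
    and "z \<in> frechet_subdifferential2 \<phi> a u \<union> uminus ` frechet_subdifferential2 \<phi> a (- u)"
    using assms(2)[OF \<open>u \<noteq> 0\<close> crit] by blast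
  then consider "z \<in> frechet_subdifferential2 \<phi> a u"
    | "- z \<in> frechet_subdifferential2 \<phi> a (- u)"
    by auto
  then show False
  proof cases
    case 1
    then have "\<forall>\<^sub>F t in at_right 0. \<phi> a < \<phi> (a + t *\<^sub>R u)"
      using assms(1) crit \<open>inner z u > 0\<close> by (intro increasing_along_direction)
    then show False
      by (intro no_increase[of 1]) (simp_all add: f_def a_def algebra_simps)
  next
    case 2
    \<comment> \<open>Negating both vectors leaves their inner product unchanged, so
      \<open>- z\<close> certifies growth in the direction \<open>- u\<close>.\<close>
    then have "\<forall>\<^sub>F t in at_right 0. \<phi> a < \<phi> (a + t *\<^sub>R (- u))"
      using assms(1) crit \<open>inner z u > 0\<close> by (intro increasing_along_direction) auto
    then show False
      by (intro no_increase[of "- 1"]) (simp_all add: f_def a_def algebra_simps)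
  qed
qed

end
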